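(* Let $\Omega:=(0,1)^2$, let $\mathcal B$ be a finite system of measurable subsets of $\Omega$ with positive Lebesgue measure, let $Z=\sum_{i=1}^N\delta_{\omega_i}$ with $\omega_1,\dots,\omega_N\in\Omega$, and let $r\colon[0,1]\to(0,\infty)$. For $B\in\mathcal B$ and $u\in L^2(\Omega)$ set $u_B:=|B|^{-1}\int_B u(\omega)\,\mathrm d\omega$ and $Z_B:=|B|^{-1}Z(B)$. Then the optimization problem $$\min_{u\in L^2(\Omega)} f(u)\quad\text{s.t.}\quad \eta(Z_B,u_B)\le r(|B|)\ \ \forall B\in\mathcal B$$ with $f\colon L^2(\Omega)\to\mathbb R\cup\{\infty\}$ can be equivalently stated as the problem with affine constraints $$\min_{u\in L^2(\Omega)} f(u)\quad\text{s.t.}\quad 0\le u_B\le r(|B|)\ \ \forall B\in\mathcal B_Z^0,\qquad \underline b(Z_B,r(|B|))\le u_B\le\overline b(Z_B,r(|B|))\ \ \forall B\in\mathcal B_Z^+,$$ i.e., both problems have the same feasible set. Here $\mathcal B_Z^0:=\{B\in\mathcal B\mid Z_B=0\}$, $\mathcal B_Z^+:=\{B\in\mathcal B\mid Z_B>0\}$, and for $a>0$, $c>0$, $$\underline b(a,c):=-a\,W_0\left(\frac{-1}{\exp(c/a+1)}\right),\qquad \overline b(a,c):=-a\,W_{-1}\left(\frac{-1}{\exp(c/a+1)}\right).$$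
   Context: $|B|$ denotes the Lebesgue measure of $B$ and $\delta_\omega$ the Dirac measure at $\omega$. The Kullback--Leibler divergence $\eta\colon\mathbb R^2\to\mathbb R\cup\{\infty\}$ is defined by $\eta(a,b):=b-a+a\ln(a/b)$ if $a>0$ and $b>0$, $\eta(a,b):=b$ if $a=0$ and $b\ge 0$, and $\eta(a,b):=\infty$ otherwise. $W_0$ and $W_{-1}$ are the two real branches of Lambert's $W$ function, the multivalued inverse of $t\mapsto t\exp(t)$: for $y\in(-1/e,0)$, $W_0(y)$ is the unique $t\in(-1,0)$ and $W_{-1}(y)$ the unique $t\in(-\infty,-1)$ with $t\exp(t)=y$. *)

theory Defs
  imports "HOL-Analysis.Analysis" "HOL-Probability.Giry_Monad"
begin

definition Omega :: "(real \<times> real) set" where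
  "Omega = {0<..<1} \<times> {0<..<1}"

abbreviation lebesgue_Omega :: "(real \<times> real) measure" where
  "lebesgue_Omega \<equiv> lebesgue_on Omega"

lemma Omega_eq_box: "Omega = box (0, 0) (1, 1)"
  by (auto simp: Omega_def box_def Basis_prod_def)

lemma Omega_sets [measurable]: "Omega \<in> sets lebesgue"
  by (simp add: Omega_eq_box)

interpretation Omega: finite_measure lebesgue_Omega
  by (rule finite_measureI)
     (auto simp: emeasure_restrict_space Omega_sets, simp add: Omega_eq_box emeasure_lborel_box_eq)


subsection \<open>The space $L^2(\Omega)$\<close>

definition square_integrable :: "(real \<times> real \<Rightarrow> real) \<Rightarrow> bool" where
  "square_integrable u \<longleftrightarrow>
     u \<in> borel_measurable lebesgue_Omega \<and> integrable lebesgue_Omega (\<lambda>x. (u x)\<^sup>2)"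

definition L2_rel :: "(real \<times> real \<Rightarrow> real) \<Rightarrow> (real \<times> real \<Rightarrow> real) \<Rightarrow> bool" where
  "L2_rel u v \<longleftrightarrow>
     square_integrable u \<and> square_integrable v \<and> (AE x in lebesgue_Omega. u x = v x)"

lemma square_integrable_zero: "square_integrable (\<lambda>_. 0)"
  by (simp add: square_integrable_def)

lemma square_integrable_scale: "square_integrable u \<Longrightarrow> square_integrable (\<lambda>x. c * u x)"
  by (auto simp: square_integrable_def power_mult_distrib)

lemma square_integrable_add:
  assumes "square_integrable u" "square_integrable v"
  shows "square_integrable (\<lambda>x. u x + v x)"
proof -
  have [measurable]: "u \<in> borel_measurable lebesgue_Omega" "v \<in> borel_measurable lebesgue_Omega"
    using assms by (auto simp: square_integrable_def)
  have "integrable lebesgue_Omega (\<lambda>x. 2 * (u x)\<^sup>2 + 2 * (v x)\<^sup>2)"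
    using assms by (auto simp: square_integrable_def)
  then have "integrable lebesgue_Omega (\<lambda>x. (u x + v x)\<^sup>2)"
  proof (rule Bochner_Integration.integrable_bound)
    have "(a + b)\<^sup>2 \<le> 2 * a\<^sup>2 + 2 * b\<^sup>2" for a b :: real
      using zero_le_power2[of "a - b"] by (simp add: power2_eq_square algebra_simps)
    then show "AE x in lebesgue_Omega.
        norm ((u x + v x)\<^sup>2) \<le> norm (2 * (u x)\<^sup>2 + 2 * (v x)\<^sup>2)"
      by simp
  qed measurable
  then show ?thesis
    by (simp add: square_integrable_def)
qed

lemma square_integrable_imp_integrable:
  assumes "square_integrable u"
  shows "integrable lebesgue_Omega u"
proof -
  have [measurable]: "u \<in> borel_measurable lebesgue_Omega"
    using assms by (auto simp: square_integrable_def)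
  have "integrable lebesgue_Omega (\<lambda>x. 1 + (u x)\<^sup>2)"
    using assms by (auto simp: square_integrable_def)
  then show ?thesis
  proof (rule Bochner_Integration.integrable_bound)
    have "\<bar>a\<bar> \<le> 1 + a\<^sup>2" for a :: real
      using zero_le_power2[of "\<bar>a\<bar> - 1"] by (simp add: power2_eq_square algebra_simps)
    then show "AE x in lebesgue_Omega. norm (u x) \<le> norm (1 + (u x)\<^sup>2)"
      by simp
  qed measurable
qed

quotient_type L2_Omega = "real \<times> real \<Rightarrow> real" / partial: L2_rel
proof (rule part_equivpI)
  show "\<exists>u. L2_rel u u"
    using square_integrable_zero by (auto simp: L2_rel_def)
  show "symp L2_rel"
    by (auto simp: symp_def L2_rel_def eq_commute)
  show "transp L2_rel"
    unfolding transp_def L2_rel_def by (auto elim: AE_mp)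
qed

instantiation L2_Omega :: real_vector
begin

lift_definition zero_L2_Omega :: L2_Omega is "\<lambda>_. 0"
  by (simp add: L2_rel_def square_integrable_zero)

lift_definition plus_L2_Omega :: "L2_Omega \<Rightarrow> L2_Omega \<Rightarrow> L2_Omega" is "\<lambda>u v x. u x + v x"
  unfolding L2_rel_def by (auto intro: square_integrable_add elim: AE_mp)

lift_definition scaleR_L2_Omega :: "real \<Rightarrow> L2_Omega \<Rightarrow> L2_Omega" is "\<lambda>c u x. c * u x"
  unfolding L2_rel_def by (auto intro: square_integrable_scale elim: AE_mp)

definition uminus_L2_Omega :: "L2_Omega \<Rightarrow> L2_Omega" where
  "uminus_L2_Omega u = (-1) *\<^sub>R u"

definition minus_L2_Omega :: "L2_Omega \<Rightarrow> L2_Omega \<Rightarrow> L2_Omega" where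
  "minus_L2_Omega u v = u + - v"

instance
proof
  fix u v w :: L2_Omega and a b :: real
  show "u + v + w = u + (v + w)"
    by transfer (auto simp: L2_rel_def add.assoc intro!: square_integrable_add)
  show "u + v = v + u"
    by transfer (auto simp: L2_rel_def add.commute intro!: square_integrable_add)
  show "0 + u = u"
    by transfer (auto simp: L2_rel_def)
  show "- u + u = 0"
    unfolding uminus_L2_Omega_def
    by transfer (auto simp: L2_rel_def square_integrable_zero)
  show "u - v = u + - v"
    by (simp add: minus_L2_Omega_def)
  show "a *\<^sub>R (u + v) = a *\<^sub>R u + a *\<^sub>R v"
    by transfer (auto simp: L2_rel_def distrib_left
        intro!: square_integrable_add square_integrable_scale)
  show "(a + b) *\<^sub>R u = a *\<^sub>R u + b *\<^sub>R u"
    by transfer (auto simp: L2_rel_def distrib_right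
        intro!: square_integrable_add square_integrable_scale)
  show "a *\<^sub>R b *\<^sub>R u = (a * b) *\<^sub>R u"
    by transfer (auto simp: L2_rel_def mult.assoc
        intro!: square_integrable_scale)
  show "1 *\<^sub>R u = u"
    by transfer (auto simp: L2_rel_def)
qed

end


subsection \<open>Averages over a set\<close>

lemma L2_rel_set_integral_cong:
  assumes "L2_rel u v"
  shows "(LINT x:B|lebesgue_Omega. u x) = (LINT x:B|lebesgue_Omega. v x)"
proof -
  let ?f = "\<lambda>u x. indicator Omega x *\<^sub>R (indicator B x *\<^sub>R (u x :: real))"
  have "AE x in lebesgue. x \<in> Omega \<longrightarrow> u x = v x"
    using assms Omega_sets by (simp add: L2_rel_def AE_restrict_space_iff)
  then have ae: "AE x in lebesgue. ?f u x = ?f v x"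
    by eventually_elim (auto split: split_indicator)
  have ae': "AE x in lebesgue. ?f v x = ?f u x"
    using ae by eventually_elim (rule sym)
  have "?f u \<in> borel_measurable lebesgue \<longleftrightarrow> ?f v \<in> borel_measurable lebesgue"
    using borel_measurable_AE[OF _ ae] borel_measurable_AE[OF _ ae'] by blast
  then have "integral\<^sup>L lebesgue (?f u) = integral\<^sup>L lebesgue (?f v)"
  proof (cases "?f u \<in> borel_measurable lebesgue")
    case True
    then show ?thesis
      using borel_measurable_AE[OF True ae] ae by (intro integral_cong_AE)
  next
    case False
    then have not_int: "\<not> integrable lebesgue (?f u)" "\<not> integrable lebesgue (?f v)"
      using \<open>?f u \<in> borel_measurable lebesgue \<longleftrightarrow> ?f v \<in> borel_measurable lebesgue\<close>
        borel_measurable_integrable by blast+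
    show ?thesis
      by (rule trans[OF not_integrable_integral_eq[OF not_int(1)]
            not_integrable_integral_eq[OF not_int(2), symmetric]])
  qed
  then show ?thesis
    unfolding set_lebesgue_integral_def
    by (subst (1 2) integral_restrict_space) (auto simp: Omega_sets)
qed

lift_definition avg :: "(real \<times> real) set \<Rightarrow> L2_Omega \<Rightarrow> real" is
  "\<lambda>B u. (LINT x:B|lebesgue_Omega. u x) / measure lebesgue B"
  using L2_rel_set_integral_cong by simp

lemma linear_avg:
  assumes "B \<in> sets lebesgue" "B \<subseteq> Omega"
  shows "linear (avg B)"
proof (rule linearI)
  have B: "B \<in> sets lebesgue_Omega"
    using assms by (simp add: sets_restrict_space_iff Omega_sets)
  have int: "set_integrable lebesgue_Omega B u" if "L2_rel u u" for u
    using that B unfolding set_integrable_def L2_rel_def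
    by (intro integrable_mult_indicator square_integrable_imp_integrable) auto
  show "avg B (u + v) = avg B u + avg B v" for u v
    by (transfer fixing: B) (simp only: set_integral_add(2)[OF int int] add_divide_distrib)
  show "avg B (c *\<^sub>R u) = c *\<^sub>R avg B u" for c u
    by (transfer fixing: B) simp
qed


subsection \<open>Point measures\<close>

text \<open>The measure $\sum_{i=1}^N \delta_{\omega_i}$ on $\Omega$.\<close>

definition dirac_sum :: "nat \<Rightarrow> (nat \<Rightarrow> real \<times> real) \<Rightarrow> (real \<times> real) measure" where
  "dirac_sum N \<omega> = measure_of Omega (sets lebesgue_Omega)
     (\<lambda>B. \<Sum>i=1..N. emeasure (return lebesgue_Omega (\<omega> i)) B)"

lemma sets_dirac_sum [simp]: "sets (dirac_sum N \<omega>) = sets lebesgue_Omega"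
  unfolding dirac_sum_def
  using sets.sigma_sets_eq[of lebesgue_Omega] sets.space_closed[of lebesgue_Omega]
  by (simp add: space_restrict_space)

lemma emeasure_dirac_sum:
  assumes "B \<in> sets lebesgue_Omega"
  shows "emeasure (dirac_sum N \<omega>) B = (\<Sum>i=1..N. emeasure (return lebesgue_Omega (\<omega> i)) B)"
proof (rule emeasure_measure_of[OF dirac_sum_def])
  show "sets lebesgue_Omega \<subseteq> Pow Omega"
    using sets.space_closed[of lebesgue_Omega] by (simp add: space_restrict_space)
  show "B \<in> sets (dirac_sum N \<omega>)"
    using assms by simp
  show "positive (sets (dirac_sum N \<omega>))
      (\<lambda>B. \<Sum>i=1..N. emeasure (return lebesgue_Omega (\<omega> i)) B)"
    by (simp add: positive_def)
  show "countably_additive (sets (dirac_sum N \<omega>))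
      (\<lambda>B. \<Sum>i=1..N. emeasure (return lebesgue_Omega (\<omega> i)) B)"
  proof (rule countably_additiveI)
    fix A :: "nat \<Rightarrow> (real \<times> real) set"
    assume A: "range A \<subseteq> sets (dirac_sum N \<omega>)" "disjoint_family A"
    have "(\<Sum>k. \<Sum>i=1..N. emeasure (return lebesgue_Omega (\<omega> i)) (A k))
        = (\<Sum>i=1..N. \<Sum>k. emeasure (return lebesgue_Omega (\<omega> i)) (A k))"
      by (rule suminf_sum) simp
    also have "\<dots> = (\<Sum>i=1..N. emeasure (return lebesgue_Omega (\<omega> i)) (\<Union>k. A k))"
      using A by (intro sum.cong refl suminf_emeasure) auto
    finally show "(\<Sum>k. \<Sum>i=1..N. emeasure (return lebesgue_Omega (\<omega> i)) (A k))
        = (\<Sum>i=1..N. emeasure (return lebesgue_Omega (\<omega> i)) (\<Union>k. A k))" .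
  qed
qed

definition density_on :: "(real \<times> real) measure \<Rightarrow> (real \<times> real) set \<Rightarrow> real" where
  "density_on Z B = measure Z B / measure lebesgue B"


subsection \<open>Kullback--Leibler divergence and Lambert's $W$ function\<close>

definition KL :: "real \<Rightarrow> real \<Rightarrow> ereal" where
  "KL a b = (if a > 0 \<and> b > 0 then ereal (b - a + a * ln (a / b))
             else if a = 0 \<and> b \<ge> 0 then ereal b
             else \<infinity>)"

text \<open>Both branches are only specified for $y \in (-1/e, 0)$.\<close>

definition Lambert_W0 :: "real \<Rightarrow> real" where
  "Lambert_W0 y = (THE t. -1 < t \<and> t < 0 \<and> t * exp t = y)"

definition Lambert_Wm1 :: "real \<Rightarrow> real" where
  "Lambert_Wm1 y = (THE t. t < -1 \<and> t * exp t = y)"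

definition b_lower :: "real \<Rightarrow> real \<Rightarrow> real" where
  "b_lower a c = - a * Lambert_W0 (- 1 / exp (c / a + 1))"

definition b_upper :: "real \<Rightarrow> real \<Rightarrow> real" where
  "b_upper a c = - a * Lambert_Wm1 (- 1 / exp (c / a + 1))"


subsection \<open>The two feasible sets\<close>

definition sets_zero ::
  "(real \<times> real) set set \<Rightarrow> (real \<times> real) measure \<Rightarrow> (real \<times> real) set set" where
  "sets_zero \<B> Z = {B \<in> \<B>. density_on Z B = 0}"

definition sets_pos ::
  "(real \<times> real) set set \<Rightarrow> (real \<times> real) measure \<Rightarrow> (real \<times> real) set set" where
  "sets_pos \<B> Z = {B \<in> \<B>. density_on Z B > 0}"

definition feasible_KL ::
  "(real \<times> real) set set \<Rightarrow> (real \<times> real) measure \<Rightarrow> (real \<Rightarrow> real) \<Rightarrow> L2_Omega set" where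
  "feasible_KL \<B> Z r =
     {u. \<forall>B\<in>\<B>. KL (density_on Z B) (avg B u) \<le> ereal (r (measure lebesgue B))}"

definition feasible_affine ::
  "(real \<times> real) set set \<Rightarrow> (real \<times> real) measure \<Rightarrow> (real \<Rightarrow> real) \<Rightarrow> L2_Omega set" where
  "feasible_affine \<B> Z r =
     {u. (\<forall>B\<in>sets_zero \<B> Z. 0 \<le> avg B u \<and> avg B u \<le> r (measure lebesgue B)) \<and>
         (\<forall>B\<in>sets_pos \<B> Z.
            b_lower (density_on Z B) (r (measure lebesgue B)) \<le> avg B u \<and>
            avg B u \<le> b_upper (density_on Z B) (r (measure lebesgue B)))}"

end

theory Submission
  imports Defs
begin

text \<open>
  Substituting $t = -b/a$ turns $\eta(a,b) \le c$ into $t e^t \le -1/\exp(c/a+1)$. Since $t e^t$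
  decreases on $(-\infty,-1]$, increases on $[-1,\infty)$ and is nonnegative for $t \ge 0$, this
  sublevel set is the interval between the two values of Lambert's $W$.
\<close>

text \<open>The derivative \<open>(1 + x) * exp x\<close> is negative for \<open>x < -1\<close>. Its
  sign is needed only strictly between \<open>s\<close> and \<open>t\<close>, so \<open>t\<close>
  may equal the critical point -1.\<close>

lemma mult_exp_strict_antimono:
  fixes s t :: real
  assumes "s < t" "t \<le> -1"
  shows "t * exp t < s * exp s"
proof (rule DERIV_neg_imp_decreasing_open[OF assms(1)])
  fix x assume "s < x" "x < t"
  then have "(1 + x) * exp x < 0"
    using assms by (intro mult_neg_pos) auto
  moreover have "((\<lambda>x. x * exp x) has_real_derivative (1 + x) * exp x) (at x)"
    by (auto intro!: derivative_eq_intros simp: algebra_simps)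
  ultimately show "\<exists>y. ((\<lambda>x. x * exp x) has_real_derivative y) (at x) \<and> y < 0"
    by blast
qed (intro continuous_intros)

lemma mult_exp_strict_mono:
  fixes s t :: real
  assumes "s < t" "-1 \<le> s"
  shows "s * exp s < t * exp t"
proof (rule DERIV_pos_imp_increasing_open[OF assms(1)])
  fix x assume "s < x" "x < t"
  then have "(1 + x) * exp x > 0"
    using assms by (intro mult_pos_pos) auto
  moreover have "((\<lambda>x. x * exp x) has_real_derivative (1 + x) * exp x) (at x)"
    by (auto intro!: derivative_eq_intros simp: algebra_simps)
  ultimately show "\<exists>y. ((\<lambda>x. x * exp x) has_real_derivative y) (at x) \<and> y > 0"
    by blast
qed (intro continuous_intros)

text \<open>Shows that the definite description denotes something: existence by the intermediate
  value theorem on [-1, 0], where \<open>t * exp t\<close> runs from \<open>- exp (-1)\<close> to 0,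
  and uniqueness by strict monotonicity.\<close>

lemma Lambert_W0_works:
  assumes "- exp (-1) < y" "y < 0"
  shows "-1 < Lambert_W0 y \<and> Lambert_W0 y < 0 \<and> Lambert_W0 y * exp (Lambert_W0 y) = y"
  unfolding Lambert_W0_def
proof (rule theI')
  have "\<exists>t\<ge>-1. t \<le> 0 \<and> t * exp t = y"
    using assms by (intro IVT') (auto intro!: continuous_intros)
  then obtain t where t: "-1 \<le> t" "t \<le> 0" "t * exp t = y"
    by blast
  moreover have "t \<noteq> -1" "t \<noteq> 0"
    using t assms by auto
  moreover have "s = t" if "-1 < s" "s * exp s = y" for s
    using that t mult_exp_strict_mono[of s t] mult_exp_strict_mono[of t s]
    by (cases s t rule: linorder_cases) auto
  ultimately show "\<exists>!t. -1 < t \<and> t < 0 \<and> t * exp t = y"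
    by (intro ex1I[of _ t]) auto
qed

text \<open>Unlike for the other branch, the interval is unbounded on the left, so the intermediate
  value theorem first needs an explicit left endpoint at which \<open>t * exp t\<close> is at least
  \<open>y\<close>.\<close>

lemma Lambert_Wm1_works:
  assumes "- exp (-1) < y" "y < 0"
  shows "Lambert_Wm1 y < -1 \<and> Lambert_Wm1 y * exp (Lambert_Wm1 y) = y"
  unfolding Lambert_Wm1_def
proof (rule theI')
  \<comment> \<open>From \<open>exp s\<close> \<ge> \<open>s\<^sup>2 / 2\<close> follows
    \<open>s * exp (- s)\<close> \<le> \<open>2 / s\<close>, and this is at most \<open>- y\<close>
    once \<open>s\<close> \<ge> \<open>- 2 / y\<close>. The maximum with 1 puts the left endpoint
    \<open>- s\<close> at or below -1.\<close>
  define s where "s = max 1 (- 2 / y)"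
  have s: "s \<ge> 1" "- 2 / y \<le> s"
    by (auto simp: s_def)
  have "2 \<le> - y * s"
    using s(2) assms(2) by (simp add: field_simps)
  then have "2 * s \<le> - y * s\<^sup>2"
    using mult_right_mono[of 2 "- y * s" s] s(1) by (simp add: power2_eq_square)
  also have "\<dots> \<le> - y * (2 * exp s)"
    using exp_lower_Taylor_quadratic[of s] s(1) assms(2) by (intro mult_left_mono) auto
  finally have "y \<le> - s * exp (- s)"
    by (simp add: exp_minus field_simps)
  then have "\<exists>t\<ge>-s. t \<le> -1 \<and> t * exp t = y"
    using assms s(1) by (intro IVT2') (auto intro!: continuous_intros)
  then obtain t where t: "t \<le> -1" "t * exp t = y"
    by blast
  moreover have "t \<noteq> -1"
    using t assms by auto
  moreover have "s = t" if "s < -1" "s * exp s = y" for s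
    using that t mult_exp_strict_antimono[of s t] mult_exp_strict_antimono[of t s]
    by (cases s t rule: linorder_cases) auto
  ultimately show "\<exists>!t. t < -1 \<and> t * exp t = y"
    by (intro ex1I[of _ t]) auto
qed

text \<open>The point -1 separates the two branch values, so on either side of it one bound holds
  automatically and strict monotonicity gives the other.\<close>

lemma mult_exp_le_iff_Lambert:
  assumes "- exp (-1) < y" "y < 0"
  shows "t * exp t \<le> y \<longleftrightarrow> Lambert_Wm1 y \<le> t \<and> t \<le> Lambert_W0 y"
proof (cases "t \<le> -1")
  case True
  then show ?thesis
    using Lambert_W0_works[OF assms] Lambert_Wm1_works[OF assms]
      mult_exp_strict_antimono[of t "Lambert_Wm1 y"] mult_exp_strict_antimono[of "Lambert_Wm1 y" t]
    by (cases t "Lambert_Wm1 y" rule: linorder_cases) auto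
next
  case False
  then show ?thesis
    using Lambert_W0_works[OF assms] Lambert_Wm1_works[OF assms]
      mult_exp_strict_mono[of t "Lambert_W0 y"] mult_exp_strict_mono[of "Lambert_W0 y" t]
    by (cases t "Lambert_W0 y" rule: linorder_cases) auto
qed

lemma KL_le_iff:
  assumes "a > 0" "c > 0"
  shows "KL a b \<le> ereal c \<longleftrightarrow> b_lower a c \<le> b \<and> b \<le> b_upper a c"
proof -
  define y where "y = - 1 / exp (c / a + 1)"
  define t where "t = - b / a"
  have b: "b = - a * t"
    using assms by (simp add: t_def)
  have y: "y = - exp (- (c / a + 1))"
    by (simp only: y_def exp_minus inverse_eq_divide)
  \<comment> \<open>Positivity of \<open>c / a\<close> puts \<open>y\<close> strictly inside the
    interval on which both branches are specified.\<close>
  have bounds: "- exp (-1) < y" "y < 0"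
    using assms by (auto simp: y)
  have "KL a b \<le> ereal c \<longleftrightarrow> t * exp t \<le> y"
  proof (cases "b > 0")
    case True
    then have t: "t < 0"
      using assms by (simp add: t_def)
    have "a / b = inverse (- t)"
      using assms by (simp add: t_def)
    then have ln_eq: "ln (a / b) = - ln (- t)"
      using t ln_inverse[of "- t"] by simp
    have "KL a b \<le> ereal c \<longleftrightarrow> b - a + a * ln (a / b) \<le> c"
      using True assms by (simp add: KL_def)
    also have "\<dots> \<longleftrightarrow> a * (- t - 1 - ln (- t)) \<le> c"
      by (simp only: ln_eq) (simp add: b algebra_simps)
    also have "\<dots> \<longleftrightarrow> - (c / a + 1) \<le> ln (- t) + t"
      using assms by (auto simp: field_simps)
    \<comment> \<open>The left side is \<open>- y\<close> and the right side is
      \<open>- t * exp t\<close>, because \<open>- t > 0\<close>; negating both reverses the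
      inequality.\<close>
    also have "\<dots> \<longleftrightarrow> exp (- (c / a + 1)) \<le> exp (ln (- t) + t)"
      by simp
    also have "\<dots> \<longleftrightarrow> t * exp t \<le> y"
      unfolding exp_add[of "ln (- t)" t] y using t by auto
    finally show ?thesis .
  next
    case False
    \<comment> \<open>Here both sides of the equivalence fail: the divergence is infinite because
      \<open>a > 0\<close> and \<open>b\<close> \<le> 0, while \<open>t * exp t\<close> is
      nonnegative and \<open>y\<close> is negative.\<close>
    then have "0 \<le> t"
      using assms by (simp add: t_def divide_nonpos_pos)
    then have "0 \<le> t * exp t"
      by simp
    then show ?thesis
      using False assms bounds by (simp add: KL_def)
  qed
  also have "\<dots> \<longleftrightarrow> Lambert_Wm1 y \<le> t \<and> t \<le> Lambert_W0 y"
    by (rule mult_exp_le_iff_Lambert[OF bounds])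
  also have "\<dots> \<longleftrightarrow> b_lower a c \<le> b \<and> b \<le> b_upper a c"
    \<comment> \<open>Multiplication by \<open>- a\<close> reverses the order, so the lower branch
      \<open>Lambert_Wm1\<close> yields the upper bound on \<open>b\<close>.\<close>
    using assms unfolding b_lower_def b_upper_def y_def[symmetric] by (auto simp: b)
  finally show ?thesis .
qed

lemma KL_zero_le_iff: "KL 0 b \<le> ereal c \<longleftrightarrow> 0 \<le> b \<and> b \<le> c"
  by (auto simp: KL_def)

lemma density_on_nonneg: "density_on Z B \<ge> 0"
  by (simp add: density_on_def)

text \<open>Places the measure in [0, 1], the range on which \<open>r\<close> is assumed
  positive.\<close>

lemma measure_subset_Omega_le_1:
  assumes "B \<in> sets lebesgue" "B \<subseteq> Omega"
  shows "measure lebesgue B \<le> 1"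
proof -
  have "measure lebesgue B \<le> measure lebesgue (box (0, 0) (1, 1) :: (real \<times> real) set)"
    using assms unfolding Omega_eq_box by (intro measure_mono_fmeasurable) auto
  then show ?thesis
    by (simp add: measure_lborel_box_eq Basis_prod_def)
qed

text \<open>The constraints can be compared set by set: since densities are nonnegative, each member
  of \<open>\<B>\<close> has density either zero or positive, and the matching scalar equivalence
  applies.\<close>

lemma feasible_KL_eq_feasible_affine:
  assumes "\<And>B. B \<in> \<B> \<Longrightarrow> r (measure lebesgue B) > 0"
  shows "feasible_KL \<B> Z r = feasible_affine \<B> Z r"
  unfolding feasible_KL_def feasible_affine_def sets_zero_def sets_pos_def
proof (intro Collect_cong)
  fix u
  have "KL (density_on Z B) (avg B u) \<le> ereal (r (measure lebesgue B)) \<longleftrightarrow>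
      (density_on Z B = 0 \<longrightarrow> 0 \<le> avg B u \<and> avg B u \<le> r (measure lebesgue B)) \<and>
      (density_on Z B > 0 \<longrightarrow>
        b_lower (density_on Z B) (r (measure lebesgue B)) \<le> avg B u \<and>
        avg B u \<le> b_upper (density_on Z B) (r (measure lebesgue B)))" if "B \<in> \<B>" for B
    using density_on_nonneg[of Z B] KL_le_iff[of "density_on Z B"] assms[OF that]
    by (cases "density_on Z B = 0") (auto simp: KL_zero_le_iff)
  then show "(\<forall>B\<in>\<B>. KL (density_on Z B) (avg B u) \<le> ereal (r (measure lebesgue B))) \<longleftrightarrow>
      (\<forall>B\<in>{B \<in> \<B>. density_on Z B = 0}. 0 \<le> avg B u \<and> avg B u \<le> r (measure lebesgue B)) \<and>
      (\<forall>B\<in>{B \<in> \<B>. density_on Z B > 0}.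
        b_lower (density_on Z B) (r (measure lebesgue B)) \<le> avg B u \<and>
        avg B u \<le> b_upper (density_on Z B) (r (measure lebesgue B)))"
    by auto
qed

theorem mainTheorem3:
  fixes \<B> :: "(real \<times> real) set set"
    and N :: nat
    and \<omega> :: "nat \<Rightarrow> real \<times> real"
    and Z :: "(real \<times> real) measure"
    and r :: "real \<Rightarrow> real"
    and f :: "L2_Omega \<Rightarrow> ereal"
  assumes "finite \<B>"
    and "\<And>B. B \<in> \<B> \<Longrightarrow> B \<in> sets lebesgue \<and> B \<subseteq> Omega \<and> measure lebesgue B > 0"
    and "\<And>i. i \<in> {1..N} \<Longrightarrow> \<omega> i \<in> Omega"
    and "Z = dirac_sum N \<omega>"
    and "\<And>x. x \<in> {0..1} \<Longrightarrow> r x > 0"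
    and "\<And>u. f u \<noteq> -\<infinity>"
  shows "feasible_KL \<B> Z r = feasible_affine \<B> Z r
    \<and> (\<forall>B\<in>\<B>. linear (avg B))
    \<and> (INF u\<in>feasible_KL \<B> Z r. f u) = (INF u\<in>feasible_affine \<B> Z r. f u)
    \<and> (\<forall>u. is_arg_min f (\<lambda>v. v \<in> feasible_KL \<B> Z r) u
          \<longleftrightarrow> is_arg_min f (\<lambda>v. v \<in> feasible_affine \<B> Z r) u)"
proof -
  have "r (measure lebesgue B) > 0" if "B \<in> \<B>" for B
    using assms(2)[OF that] measure_subset_Omega_le_1[of B] by (intro assms(5)) auto
  then have "feasible_KL \<B> Z r = feasible_affine \<B> Z r"
    by (rule feasible_KL_eq_feasible_affine)
  \<comment> \<open>Equal feasible sets give equal infima and the same minimizers; linearity of the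
    averages is what makes the bounds affine constraints.\<close>
  then show ?thesis
    using assms(2) linear_avg by simp
qed

end
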